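(* Let $D_0$ be a northeast diagram. Then the Kohnert poset $\mathcal{P}(D_0)$ is ranked if and only if $D_0$ does not contain cells $x_1=(r_1,c_1)$, $x_2=(r_2,c_2)$, $x_3=(r_3,c_3)$ such that: (a) $r_1<r_2\le r_3$; (b) $c_1=c_2<c_3$; (c) for each column $c$ with $c_1\le c<c_3$, there is at least one empty position $(r,c)$ (i.e. $(r,c)\notin D_0$) with $r<r_1$; and (d) for each column $c\ge c_3$, the number of $r<r_3$ such that $(r,c)\in D_0$ is strictly less than $r_1$.
   Context: A diagram is a finite subset of $\mathbb{N}\times\mathbb{N}$ ($\mathbb{N}=\{1,2,\dots\}$); an element $(r,c)$ is a cell in row $r$ and column $c$, rows numbered bottom to top; a position is empty if not in the diagram. A Kohnert move on $D$ selects a row, takes the rightmost cell $(r,c)$ of $D$ in that row, and moves it to $(r',c)$ where $r'$ is the largest $1\le r'<r$ with $(r',c)\notin D$ (no move if none exists). The Kohnert poset $\mathcal{P}(D)$ is the set of diagrams obtainable from $D$ by finitely many Kohnert moves (including $D$), ordered by the transitive closure of $D_2<D_1$ whenever $D_2$ results from $D_1$ by one Kohnert move. A poset $P$ is ranked if there is a function $\rho:P\to\mathbb{Z}_{\ge0}$ with $\rho(x)<\rho(y)$ whenever $x<y$ and $\rho(y)=\rho(x)+1$ whenever $y$ covers $x$ (minimal elements need not have rank $0$); equivalently, for all $x\le y$ all maximal chains from $x$ to $y$ have the same length. A diagram $D$ is northeast if for all cells $(r_1,c_1),(r_2,c_2)\in D$, $(\max(r_1,r_2),\max(c_1,c_2))\in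 D$. *)

theory Defs
  imports Main
begin

text \<open>
  A cell is a pair (row, column). Rows and columns are numbered from 1, rows from bottom to top.
\<close>

type_synonym cell = "nat \<times> nat"

definition diagram :: "cell set \<Rightarrow> bool" where
  "diagram D \<longleftrightarrow> finite D \<and> D \<subseteq> {1..} \<times> {1..}"

definition northeast :: "cell set \<Rightarrow> bool" where
  "northeast D \<longleftrightarrow>
     (\<forall>r1 c1 r2 c2. (r1, c1) \<in> D \<longrightarrow> (r2, c2) \<in> D \<longrightarrow> (max r1 r2, max c1 c2) \<in> D)"

definition rightmost_in_row :: "cell set \<Rightarrow> nat \<Rightarrow> nat \<Rightarrow> bool" where
  "rightmost_in_row D r c \<longleftrightarrow> (r, c) \<in> D \<and> (\<forall>c'. (r, c') \<in> D \<longrightarrow> c' \<le> c)"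

definition highest_empty_below :: "cell set \<Rightarrow> nat \<Rightarrow> nat \<Rightarrow> nat \<Rightarrow> bool" where
  "highest_empty_below D r c r' \<longleftrightarrow>
     1 \<le> r' \<and> r' < r \<and> (r', c) \<notin> D \<and>
     (\<forall>s. 1 \<le> s \<longrightarrow> s < r \<longrightarrow> (s, c) \<notin> D \<longrightarrow> s \<le> r')"

definition kohnert_move :: "cell set \<Rightarrow> cell set \<Rightarrow> bool" where
  "kohnert_move D D' \<longleftrightarrow>
     (\<exists>r c r'. rightmost_in_row D r c \<and> highest_empty_below D r c r' \<and>
        D' = insert (r', c) (D - {(r, c)}))"

text \<open>
  The Kohnert poset of D has the carrier \<open>kohnert_poset D\<close> and the strict order \<open>kohnert_less\<close>.
  The carrier is closed under moves, so a chain of moves starting in it never leaves it and the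
  transitive closure need not be relativised to the carrier.
\<close>

definition kohnert_poset :: "cell set \<Rightarrow> cell set set" where
  "kohnert_poset D = {D'. kohnert_move\<^sup>*\<^sup>* D D'}"

definition kohnert_less :: "cell set \<Rightarrow> cell set \<Rightarrow> bool" where
  "kohnert_less = (\<lambda>D2 D1. kohnert_move D1 D2)\<^sup>+\<^sup>+"

definition covers :: "'a set \<Rightarrow> ('a \<Rightarrow> 'a \<Rightarrow> bool) \<Rightarrow> 'a \<Rightarrow> 'a \<Rightarrow> bool" where
  "covers P lt y x \<longleftrightarrow>
     x \<in> P \<and> y \<in> P \<and> lt x y \<and> \<not> (\<exists>z\<in>P. lt x z \<and> lt z y)"

text \<open>The rank function need not vanish on minimal elements.\<close>

definition ranked :: "'a set \<Rightarrow> ('a \<Rightarrow> 'a \<Rightarrow> bool) \<Rightarrow> bool" where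
  "ranked P lt \<longleftrightarrow>
     (\<exists>\<rho> :: 'a \<Rightarrow> nat.
        (\<forall>x\<in>P. \<forall>y\<in>P. lt x y \<longrightarrow> \<rho> x < \<rho> y) \<and>
        (\<forall>x\<in>P. \<forall>y\<in>P. covers P lt y x \<longrightarrow> \<rho> y = \<rho> x + 1))"

end

theory Submission
  imports Defs
begin

text \<open>
  The sum of the row numbers is a rank function as soon as every Kohnert move that lowers a cell by
  more than one row factors into moves by a single row. This can fail only when a cell jumps over a
  cell that is blocked by another one to its right in the same row. As long as all moves are by
  single rows, counting the cells weakly below a given cell, in its own column and in the columns
  to its right, shows that such a blocked jump forces the three cells of the statement.

  Conversely, given the three cells, take \<open>c\<^sub>1\<close> maximal and then \<open>x\<^sub>3\<close> rightmost in its row. The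
  cells can then be pushed down until a blocked jump by two rows occurs. This jump is a cover, but
  moving the blocked cell out of the way before it gets blocked gives a chain one step longer.
\<close>

section \<open>Column counts, moves by one row and jumps\<close>

text \<open>The bound is strict to match condition (d). For a cell \<open>(s, c)\<close>, the value
  at \<open>Suc s\<close> is the position of the cell in its column, counted from the
  bottom.\<close>

definition cells_below :: "cell set \<Rightarrow> nat \<Rightarrow> nat \<Rightarrow> nat" where
  "cells_below D c n = card {r. 1 \<le> r \<and> r < n \<and> (r, c) \<in> D}"

definition weight :: "cell set \<Rightarrow> nat" where
  "weight D = sum fst D"

definition unit_move :: "cell set \<Rightarrow> cell set \<Rightarrow> bool" where
  "unit_move D D' \<longleftrightarrow>
     (\<exists>r c. rightmost_in_row D (Suc r) c \<and> 1 \<le> r \<and> (r, c) \<notin> D \<and>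
        D' = insert (r, c) (D - {(Suc r, c)}))"

lemma unit_moveI:
  "rightmost_in_row D (Suc r) c \<Longrightarrow> 1 \<le> r \<Longrightarrow> (r, c) \<notin> D \<Longrightarrow>
    unit_move D (insert (r, c) (D - {(Suc r, c)}))"
  unfolding unit_move_def by blast

lemma unit_move_kohnert: "unit_move D D' \<Longrightarrow> kohnert_move D D'"
  unfolding unit_move_def kohnert_move_def highest_empty_below_def
  by (metis lessI less_Suc_eq_le)

lemma unit_moves_kohnert: "(unit_move ^^ n) D D' \<Longrightarrow> kohnert_move\<^sup>*\<^sup>* D D'"
proof (induction n arbitrary: D')
  case (Suc n)
  then show ?case
    by (metis relpowp_Suc_E rtranclp.rtrancl_into_rtrancl unit_move_kohnert)
qed auto

lemma kohnert_less_iff: "kohnert_less x y \<longleftrightarrow> kohnert_move\<^sup>+\<^sup>+ y x"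
proof -
  have "(\<lambda>D2 D1. kohnert_move D1 D2) = kohnert_move\<inverse>\<inverse>" by auto
  then show ?thesis unfolding kohnert_less_def by (simp add: tranclp_converse)
qed

lemma cells_below_Suc:
  "cells_below D c (Suc n) = cells_below D c n + (if 1 \<le> n \<and> (n, c) \<in> D then 1 else 0)"
proof -
  have "{r. 1 \<le> r \<and> r < Suc n \<and> (r, c) \<in> D} =
    (if 1 \<le> n \<and> (n, c) \<in> D then insert n else id) {r. 1 \<le> r \<and> r < n \<and> (r, c) \<in> D}"
    by (auto simp: less_Suc_eq)
  then show ?thesis unfolding cells_below_def by simp
qed

lemma cells_below_le: "cells_below D c (Suc n) \<le> n"
  by (induction n) (simp_all add: cells_below_Suc[of _ _ "Suc _"], simp add: cells_below_def)

lemma cells_below_mono: "m \<le> n \<Longrightarrow> cells_below D c m \<le> cells_below D c n"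
  unfolding cells_below_def by (rule card_mono) auto

lemma cells_below_full:
  assumes "\<forall>r. 1 \<le> r \<and> r \<le> n \<longrightarrow> (r, c) \<in> D"
  shows "cells_below D c (Suc n) = n"
  using assms
  by (induction n) (simp_all add: cells_below_Suc[of _ _ "Suc _"], simp add: cells_below_def)

lemma cells_below_other_column:
  "d \<noteq> c \<Longrightarrow> cells_below (insert (r', c) (D - {(r, c)})) d n = cells_below D d n"
  unfolding cells_below_def by (rule arg_cong[where f = card]) auto

lemma cells_below_lower:
  assumes "(r, c) \<in> D" "1 \<le> r'" "r' < r" "r < n" "(r', c) \<notin> D"
  shows "cells_below (insert (r', c) (D - {(r, c)})) c n = cells_below D c n"
proof -
  let ?S = "{r. 1 \<le> r \<and> r < n \<and> (r, c) \<in> D}"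
  have eq: "{q. 1 \<le> q \<and> q < n \<and> (q, c) \<in> insert (r', c) (D - {(r, c)})} = insert r' (?S - {r})"
    using assms by auto
  have S: "r \<in> ?S" "r' \<notin> ?S - {r}" "finite ?S" using assms by auto
  then have "card (insert r' (?S - {r})) = Suc (card (?S - {r}))" by (intro card_insert_disjoint) auto
  also have "\<dots> = card ?S" using S by (intro card_Suc_Diff1)
  finally show ?thesis unfolding cells_below_def eq .
qed

text \<open>A cell going down can enter the range of rows below \<open>n\<close>, but never leave
  it.\<close>

lemma cells_below_lower_mono:
  assumes "(r, c) \<in> D" "1 \<le> r'" "r' < r" "(r', c) \<notin> D"
  shows "cells_below D d n \<le> cells_below (insert (r', c) (D - {(r, c)})) d n"
proof -
  consider "d \<noteq> c" | "d = c" "r < n" | "d = c" "n \<le> r" by linarith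
  then show ?thesis
  proof cases
    case 3
    then show ?thesis unfolding cells_below_def by (intro card_mono) auto
  qed (use assms in \<open>simp_all add: cells_below_other_column cells_below_lower\<close>)
qed

section \<open>The sum of the row numbers under moves\<close>

lemma kohnert_move_diagram: "kohnert_move D D' \<Longrightarrow> diagram D \<Longrightarrow> diagram D'"
  unfolding kohnert_move_def diagram_def rightmost_in_row_def highest_empty_below_def by auto

lemma kohnert_moves_diagram: "kohnert_move\<^sup>*\<^sup>* D D' \<Longrightarrow> diagram D \<Longrightarrow> diagram D'"
  by (induction rule: rtranclp_induct) (auto intro: kohnert_move_diagram)

lemma highest_empty_below_filled:
  "highest_empty_below D r c r' \<Longrightarrow> r' < s \<Longrightarrow> s < r \<Longrightarrow> (s, c) \<in> D"
  unfolding highest_empty_below_def by (auto simp: Suc_le_eq) (metis less_trans not_le)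

lemma weight_lower:
  assumes "finite D" "(r, c) \<in> D" "(r', c) \<notin> D"
  shows "weight (insert (r', c) (D - {(r, c)})) + r = weight D + r'"
proof -
  have "weight D = r + sum fst (D - {(r, c)})"
    unfolding weight_def using assms sum.remove[of D "(r, c)" fst] by simp
  moreover have "weight (insert (r', c) (D - {(r, c)})) = r' + sum fst (D - {(r, c)})"
    unfolding weight_def using assms by simp
  ultimately show ?thesis by simp
qed

lemma weight_kohnert_move:
  assumes "finite D" "kohnert_move D D'"
  shows "weight D' < weight D"
proof -
  obtain r c r' where m: "rightmost_in_row D r c" "highest_empty_below D r c r'"
    and D': "D' = insert (r', c) (D - {(r, c)})"
    using assms unfolding kohnert_move_def by blast
  then have "weight D' + r = weight D + r'" "r' < r"
    using weight_lower[of D r c r'] assms(1)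
    unfolding rightmost_in_row_def highest_empty_below_def by auto
  then show ?thesis by simp
qed

lemma weight_kohnert_moves:
  "kohnert_move\<^sup>+\<^sup>+ D D' \<Longrightarrow> diagram D \<Longrightarrow> weight D' < weight D"
proof (induction rule: tranclp_induct)
  case (step y z)
  then have "diagram y" using kohnert_moves_diagram by (meson tranclp_into_rtranclp)
  then show ?case using step weight_kohnert_move[of y z] unfolding diagram_def by force
qed (auto simp: diagram_def intro: weight_kohnert_move)

lemma weight_kohnert_moves_le:
  "kohnert_move\<^sup>*\<^sup>* D D' \<Longrightarrow> diagram D \<Longrightarrow> weight D' \<le> weight D"
  by (metis nless_le order_refl rtranclpD weight_kohnert_moves)

lemma weight_unit_move:
  assumes "finite D" "unit_move D D'"
  shows "weight D = Suc (weight D')"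
proof -
  obtain r c where "rightmost_in_row D (Suc r) c" "(r, c) \<notin> D"
    "D' = insert (r, c) (D - {(Suc r, c)})"
    using assms unfolding unit_move_def by blast
  then show ?thesis using weight_lower[of D "Suc r" c r] assms(1)
    unfolding rightmost_in_row_def by auto
qed

text \<open>A jump over cells that are themselves rightmost in their rows splits into unit moves,
  performed from the bottom to the top.\<close>

lemma free_stack_unit_moves:
  assumes "\<forall>s. r' < s \<and> s \<le> r' + Suc n \<longrightarrow> rightmost_in_row D s c" "1 \<le> r'" "(r', c) \<notin> D"
  shows "(unit_move ^^ Suc n) D (insert (r', c) (D - {(r' + Suc n, c)}))"
  using assms
proof (induction n arbitrary: D r')
  case 0
  then show ?case using unit_moveI[of D r' c] by (auto simp: relcompp_apply)
next
  case (Suc n)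
  define D1 where "D1 = insert (r', c) (D - {(Suc r', c)})"
  have "unit_move D D1"
    unfolding D1_def using Suc.prems by (intro unit_moveI) auto
  moreover have "(unit_move ^^ Suc n) D1 (insert (Suc r', c) (D1 - {(Suc r' + Suc n, c)}))"
  proof (rule Suc.IH)
    show "\<forall>s. Suc r' < s \<and> s \<le> Suc r' + Suc n \<longrightarrow> rightmost_in_row D1 s c"
    proof (intro allI impI)
      fix s assume "Suc r' < s \<and> s \<le> Suc r' + Suc n"
      then have "rightmost_in_row D s c" "s \<noteq> r'" "s \<noteq> Suc r'" using Suc.prems(1) by auto
      then show "rightmost_in_row D1 s c" unfolding D1_def rightmost_in_row_def by blast
    qed
  qed (auto simp: D1_def)
  moreover have "(Suc r', c) \<in> D" using Suc.prems(1) unfolding rightmost_in_row_def by force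
  then have "insert (Suc r', c) (D1 - {(Suc r' + Suc n, c)}) =
      insert (r', c) (D - {(r' + Suc (Suc n), c)})"
    unfolding D1_def by auto
  ultimately show ?case by (metis relpowp_Suc_I2)
qed

subsection \<open>Factoring jumps in the absence of an obstruction\<close>

text \<open>Every cell of \<open>D\<close> is matched with the cell of \<open>D0\<close> having the same position in its column,
  counted from the bottom; under unit moves this is the cell it descends from.\<close>

definition tracks :: "cell set \<Rightarrow> cell set \<Rightarrow> bool" where
  "tracks D0 D \<longleftrightarrow>
     (\<forall>s c. (s, c) \<in> D \<longrightarrow>
        (\<exists>s0 \<ge> s. (s0, c) \<in> D0 \<and> cells_below D c (Suc s) = cells_below D0 c (Suc s0) \<and>
          (\<forall>d > c. cells_below D0 d (Suc s0) \<le> cells_below D d (Suc s))))"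

text \<open>The moved cell was rightmost, so its old row is empty in all columns to the right, and
  counting there only up to the new row loses nothing. For every other cell the counts to the right
  can only grow, and positions within a column do not change.\<close>

lemma tracks_unit_move:
  assumes "tracks D0 D" "unit_move D D'"
  shows "tracks D0 D'"
proof -
  obtain t k where rm: "rightmost_in_row D (Suc t) k" and t: "1 \<le> t" and e: "(t, k) \<notin> D"
    and D': "D' = insert (t, k) (D - {(Suc t, k)})"
    using assms(2) unfolding unit_move_def by blast
  have inD: "(Suc t, k) \<in> D" and right: "\<And>d. k < d \<Longrightarrow> (Suc t, d) \<notin> D"
    using rm unfolding rightmost_in_row_def by (auto simp: not_le[symmetric])
  have mono: "cells_below D d n \<le> cells_below D' d n" for d n
    unfolding D' using inD t e by (intro cells_below_lower_mono) auto
  have other: "d \<noteq> k \<Longrightarrow> cells_below D' d n = cells_below D d n" for d n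
    unfolding D' by (rule cells_below_other_column)
  \<comment> \<open>Only the count strictly below row \<open>Suc t\<close> changes: it gains the
    cell arriving in row \<open>t\<close>.\<close>
  have same: "cells_below D' k n = cells_below D k n" if "n \<noteq> Suc t" for n
  proof (cases "Suc t < n")
    case True
    then show ?thesis unfolding D' using inD t e by (intro cells_below_lower) auto
  next
    case False
    then show ?thesis unfolding D' cells_below_def using that
      by (intro arg_cong[where f = card]) auto
  qed
  show ?thesis unfolding tracks_def
  proof (intro allI impI)
    fix s c assume sc: "(s, c) \<in> D'"
    show "\<exists>s0 \<ge> s. (s0, c) \<in> D0 \<and> cells_below D' c (Suc s) = cells_below D0 c (Suc s0) \<and>
          (\<forall>d > c. cells_below D0 d (Suc s0) \<le> cells_below D' d (Suc s))"
    proof (cases "(s, c) = (t, k)")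
      case True
      obtain s0 where s0: "s0 \<ge> Suc t" "(s0, k) \<in> D0"
        "cells_below D k (Suc (Suc t)) = cells_below D0 k (Suc s0)"
        "\<forall>d > k. cells_below D0 d (Suc s0) \<le> cells_below D d (Suc (Suc t))"
        using assms(1) inD unfolding tracks_def by blast
      have "cells_below D' k (Suc t) = cells_below D' k (Suc (Suc t))"
        using cells_below_Suc[of D' k "Suc t"] D' by simp
      then have "cells_below D' k (Suc t) = cells_below D0 k (Suc s0)"
        using same[of "Suc (Suc t)"] s0(3) by simp
      moreover have "cells_below D0 d (Suc s0) \<le> cells_below D' d (Suc t)" if "d > k" for d
        using s0(4) that right[OF that] cells_below_Suc[of D d "Suc t"] other[of d "Suc t"] by auto
      ultimately show ?thesis using True s0(1,2) by (intro exI[of _ s0]) auto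
    next
      case False
      then have "(s, c) \<in> D" "c = k \<Longrightarrow> s \<noteq> t" using sc D' by auto
      then obtain s0 where s0: "s0 \<ge> s" "(s0, c) \<in> D0"
        "cells_below D c (Suc s) = cells_below D0 c (Suc s0)"
        "\<forall>d > c. cells_below D0 d (Suc s0) \<le> cells_below D d (Suc s)"
        using assms(1) unfolding tracks_def by blast
      have "cells_below D' c (Suc s) = cells_below D c (Suc s)"
        using same[of "Suc s"] other[of c "Suc s"] \<open>c = k \<Longrightarrow> s \<noteq> t\<close> by (cases "c = k") auto
      then show ?thesis
        using s0 mono by (intro exI[of _ s0]) (auto intro: le_trans)
    qed
  qed
qed

lemma tracks_refl: "tracks D D"
  unfolding tracks_def by auto

lemma tracks_unit_moves: "unit_move\<^sup>*\<^sup>* D0 D \<Longrightarrow> tracks D0 D"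
  by (induction rule: rtranclp_induct) (auto intro: tracks_refl tracks_unit_move)

definition ranking_obstruction :: "cell set \<Rightarrow> nat \<Rightarrow> nat \<Rightarrow> nat \<Rightarrow> nat \<Rightarrow> nat \<Rightarrow> bool" where
  "ranking_obstruction D r1 r2 r3 c1 c3 \<longleftrightarrow>
     (r1, c1) \<in> D \<and> (r2, c1) \<in> D \<and> (r3, c3) \<in> D \<and> r1 < r2 \<and> r2 \<le> r3 \<and> c1 < c3 \<and>
     (\<forall>c. c1 \<le> c \<and> c < c3 \<longrightarrow> (\<exists>r. 1 \<le> r \<and> r < r1 \<and> (r, c) \<notin> D)) \<and>
     (\<forall>c \<ge> c3. cells_below D c r3 < r1)"

lemma northeastD:
  "northeast D \<Longrightarrow> (r1, c1) \<in> D \<Longrightarrow> (r2, c2) \<in> D \<Longrightarrow> r2 \<le> r1 \<Longrightarrow> c1 \<le> c2 \<Longrightarrow> (r1, c2) \<in> D"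
  unfolding northeast_def by (metis max.absorb1 max.absorb2)

lemma cells_below_pos: "0 < cells_below D c n \<Longrightarrow> \<exists>r \<ge> 1. r < n \<and> (r, c) \<in> D"
  unfolding cells_below_def by (metis (mono_tags, lifting) card_gt_0_iff ex_in_conv mem_Collect_eq)

text \<open>The obstruction consists of the origins in \<open>D0\<close> of \<open>(s, k)\<close>
  and \<open>(Suc s, k)\<close>, and of a cell in the column of a cell blocking
  \<open>(s, k)\<close>. If (c) or (d) failed, northeastness would make a column of
  \<open>D0\<close> so full that \<open>tracks\<close> demands more cells in rows up to
  \<open>s\<close> of \<open>D\<close> than fit there.\<close>

lemma blocked_cell_obstruction:
  assumes "northeast D0" "tracks D0 D"
    and x1: "(s, k) \<in> D" and x2: "rightmost_in_row D (Suc s) k"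
    and blocked: "\<not> rightmost_in_row D s k"
    and hole: "1 \<le> h" "h < s" "(h, k) \<notin> D"
  shows "\<exists>r1 r2 r3 c1 c3. ranking_obstruction D0 r1 r2 r3 c1 c3"
proof (rule ccontr)
  assume none: "\<not> ?thesis"
  have x2D: "(Suc s, k) \<in> D" and right: "\<And>d. k < d \<Longrightarrow> (Suc s, d) \<notin> D"
    using x2 unfolding rightmost_in_row_def by (auto simp: not_le[symmetric])
  obtain m where m: "k < m" "(s, m) \<in> D"
    using x1 blocked unfolding rightmost_in_row_def by (auto simp: not_le)
  obtain r1 where r1: "r1 \<ge> s" "(r1, k) \<in> D0"
    "cells_below D k (Suc s) = cells_below D0 k (Suc r1)"
    using assms(2) x1 unfolding tracks_def by blast
  obtain r2 where r2: "(r2, k) \<in> D0"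
    "cells_below D k (Suc (Suc s)) = cells_below D0 k (Suc r2)"
    "\<forall>d > k. cells_below D0 d (Suc r2) \<le> cells_below D d (Suc (Suc s))"
    using assms(2) x2D unfolding tracks_def by blast
  obtain y where y: "(y, m) \<in> D0"
    "cells_below D m (Suc s) = cells_below D0 m (Suc y)"
    "\<forall>d > m. cells_below D0 d (Suc y) \<le> cells_below D d (Suc s)"
    using assms(2) m(2) unfolding tracks_def by blast
  \<comment> \<open>The two cells are adjacent in column \<open>k\<close>, so their positions, which
    their origins share, differ by one.\<close>
  have "cells_below D0 k (Suc r2) = Suc (cells_below D0 k (Suc r1))"
    using r1 r2 x2D cells_below_Suc[of D k "Suc s"] by simp
  then have r12: "r1 < r2"
    using cells_below_mono[of "Suc r2" "Suc r1" D0 k] by (cases "r1 < r2") simp_all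
  have r1_pos: "1 < r1" using hole r1(1) by linarith
  text \<open>Otherwise the cell from \<open>(r2, k)\<close> would never become free as low as row \<open>Suc s\<close>.\<close>
  have few: "cells_below D0 d r2 < r1" if "k < d" for d
  proof (rule ccontr)
    assume "\<not> ?thesis"
    then have ge: "r1 \<le> cells_below D0 d r2" by simp
    then obtain q where "q < r2" "(q, d) \<in> D0" using cells_below_pos[of D0 d r2] r1_pos by auto
    then have "(r2, d) \<in> D0" using northeastD[OF assms(1) r2(1)] that by auto
    then have "Suc r1 \<le> cells_below D0 d (Suc r2)"
      using ge cells_below_Suc[of D0 d r2] r12 by simp
    also have "\<dots> \<le> cells_below D d (Suc (Suc s))" using r2(3) that by blast
    also have "\<dots> = cells_below D d (Suc s)"
      using cells_below_Suc[of D d "Suc s"] right[OF that] by simp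
    also have "\<dots> \<le> s" by (rule cells_below_le)
    finally show False using r1(1) by simp
  qed
  \<comment> \<open>The origin \<open>(y, m)\<close> of the blocking cell may lie below row
    \<open>r2\<close>; the northeast property then supplies \<open>(r2, m)\<close>.\<close>
  define r3 where "r3 = max r2 y"
  have r3m: "(r3, m) \<in> D0"
    using northeastD[OF assms(1) r2(1) y(1)] y(1) m(1) unfolding r3_def max_def by auto
  \<comment> \<open>A column full below row \<open>r1\<close> also contains \<open>(r1, c)\<close>.
    For \<open>c = k\<close> this puts \<open>(s, k)\<close> at position \<open>r1\<close>, which is
    at least \<open>s\<close>, although the hole leaves it at most \<open>s - 1\<close>. For
    \<open>c > k\<close> it contradicts \<open>few\<close>.\<close>
  have c: "\<exists>r. 1 \<le> r \<and> r < r1 \<and> (r, c) \<notin> D0" if "k \<le> c" for c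
  proof (rule ccontr)
    assume "\<not> ?thesis"
    then have full: "\<forall>r. 1 \<le> r \<and> r \<le> r1 - 1 \<longrightarrow> (r, c) \<in> D0" using r1_pos by auto
    have full_at: "(r1, c) \<in> D0"
      using northeastD[OF assms(1) r1(2), of 1 c] full r1_pos that by auto
    then have eq: "cells_below D0 c (Suc r1) = r1"
      using full r1_pos by (intro cells_below_full) (metis Suc_pred' le_SucE less_trans zero_less_one)
    show False
    proof (cases "c = k")
      case True
      then have "cells_below D k (Suc s) = r1" using eq r1(3) by simp
      moreover have "{r. 1 \<le> r \<and> r < Suc s \<and> (r, k) \<in> D} \<subseteq> {1..s} - {h}" using hole by auto
      then have "cells_below D k (Suc s) \<le> card ({1..s} - {h})"
        unfolding cells_below_def by (intro card_mono) auto
      moreover have "card ({1..s} - {h}) < s" using hole by simp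
      ultimately show False using r1(1) by simp
    next
      case False
      then show False
        using few[of c] eq that cells_below_mono[of "Suc r1" r2 D0 c] r12 by simp
    qed
  qed
  \<comment> \<open>If \<open>y > r2\<close>, the count from \<open>few\<close> is repeated with the
    blocking cell, which sits in row \<open>s\<close>, in place of
    \<open>(Suc s, k)\<close>.\<close>
  have d: "cells_below D0 d r3 < r1" if "m \<le> d" for d
  proof (cases "y \<le> r2")
    case True
    then show ?thesis using few[of d] that m(1) unfolding r3_def by simp
  next
    case False
    then have r3: "r3 = y" unfolding r3_def by simp
    show ?thesis
    proof (rule ccontr)
      assume "\<not> ?thesis"
      then have ge: "r1 \<le> cells_below D0 d y" using r3 by simp
      then obtain q where "q < y" "(q, d) \<in> D0" using cells_below_pos[of D0 d y] r1_pos by auto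
      then have "(y, d) \<in> D0" using northeastD[OF assms(1) y(1)] that by auto
      then have "Suc r1 \<le> cells_below D0 d (Suc y)"
        using ge cells_below_Suc[of D0 d y] False by simp
      also have "\<dots> \<le> cells_below D d (Suc s)" using y(2,3) that by (cases "d = m") auto
      also have "\<dots> \<le> s" by (rule cells_below_le)
      finally show False using r1(1) by simp
    qed
  qed
  have "ranking_obstruction D0 r1 r2 r3 k m"
    unfolding ranking_obstruction_def using r1 r2 r3m r12 m(1) c d by (auto simp: r3_def)
  then show False using none by blast
qed

text \<open>Going down from the moving cell, each cell jumped over is free in its row: the first
  blocked one would have a free cell directly above it and the hole \<open>r'\<close> below it,
  which yields an obstruction.\<close>

lemma unobstructed_move_splits:
  assumes "northeast D0" "tracks D0 D"
    and none: "\<nexists>r1 r2 r3 c1 c3. ranking_obstruction D0 r1 r2 r3 c1 c3"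
    and "kohnert_move D D'"
  shows "\<exists>n. (unit_move ^^ Suc n) D D'"
proof -
  obtain r c r' where rm: "rightmost_in_row D r c" and he: "highest_empty_below D r c r'"
    and D': "D' = insert (r', c) (D - {(r, c)})"
    using assms unfolding kohnert_move_def by blast
  have r': "1 \<le> r'" "r' < r" "(r', c) \<notin> D"
    using he unfolding highest_empty_below_def by auto
  note filled = highest_empty_below_filled[OF he]
  have free: "rightmost_in_row D s c" if "s \<le> r" "r' < s" for s
    using that
  proof (induction s rule: inc_induct)
    case (step s)
    show ?case
    proof (rule ccontr)
      assume "\<not> ?thesis"
      then show False
        using blocked_cell_obstruction[OF assms(1,2), of s c r'] none filled step r' by auto
    qed
  qed (rule rm)
  obtain n where "r = r' + Suc n" using r'(2) less_imp_Suc_add by auto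
  then show ?thesis using free_stack_unit_moves[of r' n D c] free r' D' by auto
qed

text \<open>Splitting a move relies on \<open>tracks\<close>, which in turn comes from unit moves;
  induction on the number of moves interleaves the two.\<close>

lemma unobstructed_tracks:
  assumes "northeast D0"
    and none: "\<nexists>r1 r2 r3 c1 c3. ranking_obstruction D0 r1 r2 r3 c1 c3"
    and "kohnert_move\<^sup>*\<^sup>* D0 D"
  shows "tracks D0 D"
proof -
  have "unit_move\<^sup>*\<^sup>* D0 D"
    using assms(3)
  proof (induction rule: rtranclp_induct)
    case (step y z)
    then obtain n where "(unit_move ^^ Suc n) y z"
      using unobstructed_move_splits[OF assms(1) tracks_unit_moves none] by blast
    then show ?case using step by (meson relpowp_imp_rtranclp rtranclp_trans)
  qed auto
  then show ?thesis by (rule tracks_unit_moves)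
qed

lemma unobstructed_ranked:
  assumes "diagram D0" "northeast D0"
    and none: "\<nexists>r1 r2 r3 c1 c3. ranking_obstruction D0 r1 r2 r3 c1 c3"
  shows "ranked (kohnert_poset D0) kohnert_less"
proof -
  have dia: "diagram x" if "x \<in> kohnert_poset D0" for x
    using that kohnert_moves_diagram assms(1) unfolding kohnert_poset_def by auto
  have "weight x < weight y" if "x \<in> kohnert_poset D0" "y \<in> kohnert_poset D0" "kohnert_less x y"
    for x y using that weight_kohnert_moves dia unfolding kohnert_less_iff by blast
  moreover have "weight y = weight x + 1"
    if x: "x \<in> kohnert_poset D0" and y: "y \<in> kohnert_poset D0"
      and cov: "covers (kohnert_poset D0) kohnert_less y x" for x y
  proof -
    have closed: "z \<in> kohnert_poset D0" if "kohnert_move\<^sup>*\<^sup>* y z" for z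
      using y that unfolding kohnert_poset_def by auto
    have yx: "kohnert_move\<^sup>+\<^sup>+ y x"
      and between: "\<And>z. kohnert_move\<^sup>+\<^sup>+ y z \<Longrightarrow> kohnert_move\<^sup>+\<^sup>+ z x \<Longrightarrow> False"
      using cov closed unfolding covers_def kohnert_less_iff by (auto dest: tranclp_into_rtranclp)
    then have "kohnert_move y x"
      by (metis tranclp.cases tranclp.r_into_trancl)
    then obtain n where n: "(unit_move ^^ Suc n) y x"
      using unobstructed_move_splits[OF assms(2) _ none] unobstructed_tracks[OF assms(2,3)] y
      unfolding kohnert_poset_def by blast
    then obtain z where z: "unit_move y z" "(unit_move ^^ n) z x" by (rule relpowp_Suc_E2)
    \<comment> \<open>The first unit move already lands on \<open>x\<close>, as otherwise
      \<open>z\<close> would lie strictly between.\<close>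
    have "z = x"
      using between[of z] z unit_move_kohnert unit_moves_kohnert
      by (metis rtranclpD tranclp.r_into_trancl)
    then show ?thesis using weight_unit_move[of y x] z(1) dia[OF y] unfolding diagram_def by simp
  qed
  ultimately show ?thesis unfolding ranked_def by blast
qed

subsection \<open>Blocked jumps\<close>

definition shift_row :: "cell set \<Rightarrow> nat \<Rightarrow> nat \<Rightarrow> cell set" where
  "shift_row D t k =
     (D - {(Suc t, c) | c. k \<le> c}) \<union> {(t, c) | c. k \<le> c \<and> (Suc t, c) \<in> D}"

lemma shift_row_iff:
  "(r, c) \<in> shift_row D t k \<longleftrightarrow>
     (r, c) \<in> D \<and> (r = Suc t \<longrightarrow> c < k) \<or> r = t \<and> k \<le> c \<and> (Suc t, c) \<in> D"
  unfolding shift_row_def by auto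

text \<open>The cells go down from right to left, so each is rightmost when its turn comes. The
  exact number of moves is kept for comparing lengths of chains.\<close>

lemma shift_row_unit_moves:
  assumes "finite D" "1 \<le> t" "\<forall>c \<ge> k. (Suc t, c) \<in> D \<longrightarrow> (t, c) \<notin> D"
    and "card {c. k \<le> c \<and> (Suc t, c) \<in> D} = n"
  shows "(unit_move ^^ n) D (shift_row D t k)"
  using assms
proof (induction n arbitrary: D)
  case (0 D)
  have "finite {c. k \<le> c \<and> (Suc t, c) \<in> D}"
    by (rule finite_subset[of _ "snd ` D"]) (use 0 in \<open>force+\<close>)
  then have "{c. k \<le> c \<and> (Suc t, c) \<in> D} = {}" using 0 by simp
  then have "shift_row D t k = D" unfolding shift_row_def by auto
  then show ?case by simp
next
  case (Suc n D)
  let ?S = "\<lambda>D. {c. k \<le> c \<and> (Suc t, c) \<in> D}"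
  have fin: "finite (?S D)"
    by (rule finite_subset[of _ "snd ` D"]) (use Suc.prems in \<open>force+\<close>)
  moreover have "?S D \<noteq> {}" using Suc.prems(4) by (metis card.empty nat.distinct(1))
  ultimately have "Max (?S D) \<in> ?S D" "\<forall>c \<in> ?S D. c \<le> Max (?S D)"
    using Max_in Max_ge by blast+
  then obtain m where m: "k \<le> m" "(Suc t, m) \<in> D" and max: "\<And>c. k \<le> c \<Longrightarrow> (Suc t, c) \<in> D \<Longrightarrow> c \<le> m"
    by blast
  define D1 where "D1 = insert (t, m) (D - {(Suc t, m)})"
  have "rightmost_in_row D (Suc t) m"
    unfolding rightmost_in_row_def using m max by (metis le_trans nle_le)
  then have mv: "unit_move D D1"
    unfolding D1_def using Suc.prems m by (intro unit_moveI) auto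
  have "?S D1 = ?S D - {m}" unfolding D1_def by auto
  then have card1: "card (?S D1) = n" using fin m Suc.prems(4) by simp
  have "(unit_move ^^ n) D1 (shift_row D1 t k)"
    using Suc.prems(1-3) card1 unfolding D1_def by (intro Suc.IH) auto
  moreover have "shift_row D1 t k = shift_row D t k"
    unfolding D1_def shift_row_def using m by auto
  ultimately show ?case using mv by (metis relpowp_Suc_I2)
qed

lemma shift_row_reachable:
  assumes "finite D" "1 \<le> t" "\<forall>c \<ge> k. (Suc t, c) \<in> D \<longrightarrow> (t, c) \<notin> D" "(Suc t, k) \<in> D"
  shows "kohnert_move\<^sup>+\<^sup>+ D (shift_row D t k)"
proof -
  have "kohnert_move\<^sup>*\<^sup>* D (shift_row D t k)"
    using unit_moves_kohnert shift_row_unit_moves[OF assms(1-3) refl] by blast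
  moreover have "(Suc t, k) \<notin> shift_row D t k" by (simp add: shift_row_iff)
  ultimately show ?thesis using assms(4) by (metis rtranclpD)
qed

text \<open>The situation just before the jump: \<open>(Suc q, k)\<close> is still free, and will be
  blocked once the cells to the right of column \<open>k\<close> in the row above come down.\<close>

definition blocked_jump :: "cell set \<Rightarrow> nat \<Rightarrow> nat \<Rightarrow> bool" where
  "blocked_jump E q k \<longleftrightarrow>
     1 \<le> q \<and> (q, k) \<notin> E \<and> (Suc q, k) \<in> E \<and> (Suc (Suc q), k) \<in> E \<and>
     (\<forall>c > k. (Suc q, c) \<notin> E) \<and> (\<exists>c > k. (Suc (Suc q), c) \<in> E)"

lemma kohnert_poset_closed:
  "D \<in> kohnert_poset D0 \<Longrightarrow> kohnert_move\<^sup>*\<^sup>* D E \<Longrightarrow> E \<in> kohnert_poset D0"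
  unfolding kohnert_poset_def by auto

text \<open>The weight drops by exactly one, which leaves no room for an intermediate
  diagram.\<close>

lemma unit_move_covers:
  assumes "diagram D0" "D \<in> kohnert_poset D0" "unit_move D D'"
  shows "covers (kohnert_poset D0) kohnert_less D D'"
proof -
  have D: "diagram D"
    using assms kohnert_moves_diagram unfolding kohnert_poset_def by auto
  have km: "kohnert_move D D'" using assms(3) by (rule unit_move_kohnert)
  have w: "weight D = Suc (weight D')"
    using weight_unit_move assms(3) D unfolding diagram_def by blast
  have "False" if "kohnert_move\<^sup>+\<^sup>+ D z" "kohnert_move\<^sup>+\<^sup>+ z D'" for z
  proof -
    have "diagram z" using kohnert_moves_diagram that(1) D by (meson tranclp_into_rtranclp)
    then show False using weight_kohnert_moves[OF that(1) D] weight_kohnert_moves[OF that(2)] w by simp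
  qed
  moreover have "D' \<in> kohnert_poset D0" using kohnert_poset_closed assms(2) km by blast
  ultimately show ?thesis
    unfolding covers_def kohnert_less_iff using assms(2) km by blast
qed

text \<open>The weight drops by two, so an intermediate diagram would give two moves by a single
  row. The jumping cell cannot make the first one, since the position below it is occupied, and the
  blocked cell cannot make it either.\<close>

lemma blocked_jump_covers:
  assumes "diagram D0" "D \<in> kohnert_poset D0" "1 \<le> q" "(q, k) \<notin> D" "(Suc q, k) \<in> D"
    and rm: "rightmost_in_row D (Suc (Suc q)) k" and blocked: "\<not> rightmost_in_row D (Suc q) k"
  shows "covers (kohnert_poset D0) kohnert_less D (insert (q, k) (D - {(Suc (Suc q), k)}))"
    (is "covers _ _ _ ?D'")
proof -
  have D: "diagram D"
    using assms kohnert_moves_diagram unfolding kohnert_poset_def by auto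
  then have fin: "finite D" unfolding diagram_def by simp
  have top: "(Suc (Suc q), k) \<in> D" using rm unfolding rightmost_in_row_def by blast
  have "highest_empty_below D (Suc (Suc q)) k q"
    unfolding highest_empty_below_def using assms(3-5) by (auto simp: less_Suc_eq)
  then have km: "kohnert_move D ?D'" unfolding kohnert_move_def using rm by blast
  have w: "weight D = weight ?D' + 2" using weight_lower[OF fin top assms(4)] by simp
  have "False" if z: "kohnert_move\<^sup>+\<^sup>+ D z" "kohnert_move\<^sup>+\<^sup>+ z ?D'" for z
  proof -
    obtain y where y: "kohnert_move D y" "kohnert_move\<^sup>*\<^sup>* y z" using z(1) by (metis tranclpD)
    then have y': "kohnert_move\<^sup>+\<^sup>+ y ?D'" using z(2) by (metis rtranclp_tranclp_tranclp)
    then obtain x where x: "kohnert_move y x" "kohnert_move\<^sup>*\<^sup>* x ?D'" by (metis tranclpD)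
    have dy: "diagram y" "diagram x" using kohnert_move_diagram y(1) x(1) D by blast+
    then have fy: "finite y" unfolding diagram_def by simp
    have wyx: "weight y < weight D" "weight x < weight y" "weight ?D' \<le> weight x"
      using weight_kohnert_move y(1) x(1) fin fy weight_kohnert_moves_le[OF x(2) dy(2)] by blast+
    \<comment> \<open>Two moves use up the whole drop in weight, so no move is left between
      \<open>x\<close> and the target.\<close>
    have xD: "x = ?D'"
      using wyx w x(2) weight_kohnert_moves[of x ?D'] dy(2) by (auto dest!: rtranclpD)
    obtain r c r' where m1: "rightmost_in_row D r c" "highest_empty_below D r c r'"
      and yD: "y = insert (r', c) (D - {(r, c)})"
      using y(1) unfolding kohnert_move_def by blast
    obtain t d t' where m2: "rightmost_in_row y t d" "highest_empty_below y t d t'"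
      and xy: "x = insert (t', d) (y - {(t, d)})"
      using x(1) unfolding kohnert_move_def by blast
    have in1: "(r, c) \<in> D" "(r', c) \<notin> D" "r' < r" and in2: "(t, d) \<in> y" "(t', d) \<notin> y" "t' < t"
      using m1 m2 unfolding rightmost_in_row_def highest_empty_below_def by auto
    have r: "r = Suc r'" and t: "t = Suc t'"
      using weight_lower[OF fin in1(1,2)] weight_lower[OF fy in2(1,2)] yD xy in1(3) in2(3) wyx w
      by auto
    have eq: "insert (t', d) (insert (r', c) (D - {(r, c)}) - {(t, d)}) =
        insert (q, k) (D - {(Suc (Suc q), k)})"
      using xD xy yD by simp
    show False
    proof (cases "(r, c) = (Suc (Suc q), k)")
      case True
      then show False using in1(2) r assms(5) by simp
    next
      case False
      \<comment> \<open>The position vacated first is occupied in the target, so the second move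
        refills it. The only new position is then \<open>(r', c)\<close>, which must be
        \<open>(q, k)\<close>, so the first move took the blocked cell.\<close>
      then have "(r, c) \<in> insert (t', d) (insert (r', c) (D - {(r, c)}) - {(t, d)})"
        using eq in1(1) by auto
      then have td: "t' = r" "d = c" using in1 by auto
      then have "(r', c) \<in> insert (t', d) (insert (r', c) (D - {(r, c)}) - {(t, d)})"
        using r t by auto
      then have "(r', c) = (q, k)" using eq in1(2) by auto
      then show False using m1(1) r blocked by simp
    qed
  qed
  moreover have "?D' \<in> kohnert_poset D0" using kohnert_poset_closed assms(2) km by blast
  ultimately show ?thesis
    unfolding covers_def kohnert_less_iff using assms(2) km by blast
qed

text \<open>Two routes from \<open>E\<close> to the same diagram: either the cells right of column \<open>k\<close> in row
  \<open>Suc (Suc q)\<close> come down first and the cell \<open>(Suc (Suc q), k)\<close> jumps over the blocked cell below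
  it, or the cell \<open>(Suc q, k)\<close> moves first and no jump is needed. All steps of the first route are
  covers, and it is one step shorter.\<close>

lemma blocked_jump_not_ranked:
  assumes "diagram D0" "E \<in> kohnert_poset D0" "blocked_jump E q k"
  shows "\<not> ranked (kohnert_poset D0) kohnert_less"
proof
  assume "ranked (kohnert_poset D0) kohnert_less"
  then obtain \<rho> :: "cell set \<Rightarrow> nat" where
    less: "\<And>x y. x \<in> kohnert_poset D0 \<Longrightarrow> y \<in> kohnert_poset D0 \<Longrightarrow> kohnert_less x y \<Longrightarrow> \<rho> x < \<rho> y"
    and cov: "\<And>x y. x \<in> kohnert_poset D0 \<Longrightarrow> y \<in> kohnert_poset D0 \<Longrightarrow>
      covers (kohnert_poset D0) kohnert_less y x \<Longrightarrow> \<rho> y = \<rho> x + 1"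
    unfolding ranked_def by blast
  have rank_unit: "\<rho> y = \<rho> z + n" if "(unit_move ^^ n) y z" "y \<in> kohnert_poset D0" for n y z
    using that
  proof (induction n arbitrary: z)
    case (Suc n)
    then obtain x where x: "(unit_move ^^ n) y x" "unit_move x z" by (metis relpowp_Suc_E)
    then have "x \<in> kohnert_poset D0" "z \<in> kohnert_poset D0"
      using kohnert_poset_closed Suc.prems unit_moves_kohnert by blast+
    then show ?case
      using cov[of z x] unit_move_covers[OF assms(1) _ x(2)] Suc.IH[OF x(1) Suc.prems(2)] by simp
  qed simp
  have q: "1 \<le> q" "(q, k) \<notin> E" "(Suc q, k) \<in> E" "(Suc (Suc q), k) \<in> E"
    and row: "\<And>c. k < c \<Longrightarrow> (Suc q, c) \<notin> E" and "\<exists>m > k. (Suc (Suc q), m) \<in> E"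
    using assms(3) unfolding blocked_jump_def by auto
  then obtain m where m: "k < m" "(Suc (Suc q), m) \<in> E" by blast
  have finE: "finite E"
    using assms(1,2) kohnert_moves_diagram unfolding kohnert_poset_def diagram_def by blast
  define n where "n = card {c. Suc k \<le> c \<and> (Suc (Suc q), c) \<in> E}"
  \<comment> \<open>The short route \<open>E\<close>, \<open>E1\<close>, \<open>E2\<close> has
    \<open>n\<close> unit moves and one jump; the long route via \<open>F\<close> has
    \<open>1 + Suc n\<close> unit moves.\<close>
  define E1 where "E1 = shift_row E (Suc q) (Suc k)"
  define E2 where "E2 = insert (q, k) (E1 - {(Suc (Suc q), k)})"
  define F where "F = insert (q, k) (E - {(Suc q, k)})"
  have E1: "(unit_move ^^ n) E E1"
    unfolding E1_def n_def using finE row by (intro shift_row_unit_moves) auto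
  have E1P: "E1 \<in> kohnert_poset D0"
    using kohnert_poset_closed assms(2) E1 unit_moves_kohnert by blast
  have E1_in: "(q, k) \<notin> E1" "(Suc q, k) \<in> E1" "rightmost_in_row E1 (Suc (Suc q)) k"
    "(Suc q, m) \<in> E1"
    using q m unfolding E1_def rightmost_in_row_def shift_row_iff by auto
  then have "\<not> rightmost_in_row E1 (Suc q) k"
    using m(1) unfolding rightmost_in_row_def by (auto simp: not_le)
  have c: "covers (kohnert_poset D0) kohnert_less E1 E2"
    unfolding E2_def using E1_in E1P assms(1) q(1) \<open>\<not> rightmost_in_row E1 (Suc q) k\<close>
    by (intro blocked_jump_covers)
  then have E2P: "E2 \<in> kohnert_poset D0" unfolding covers_def by blast
  have "rightmost_in_row E (Suc q) k"
    unfolding rightmost_in_row_def using q(3) row by (metis not_le)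
  then have F: "unit_move E F" unfolding F_def using q by (intro unit_moveI)
  have "{c. k \<le> c \<and> (Suc (Suc q), c) \<in> F} = insert k {c. Suc k \<le> c \<and> (Suc (Suc q), c) \<in> E}"
    using q(4) unfolding F_def by auto
  moreover have "finite {c. Suc k \<le> c \<and> (Suc (Suc q), c) \<in> E}"
    by (rule finite_subset[of _ "snd ` E"]) (use finE in \<open>force+\<close>)
  ultimately have "card {c. k \<le> c \<and> (Suc (Suc q), c) \<in> F} = Suc n"
    unfolding n_def by simp
  then have "(unit_move ^^ Suc n) F (shift_row F (Suc q) k)"
    using finE row unfolding F_def
    by (intro shift_row_unit_moves) (auto simp: le_less)
  moreover have "shift_row F (Suc q) k = E2"
    unfolding set_eq_iff split_paired_All
  proof (intro allI)
    fix r c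
    show "(r, c) \<in> shift_row F (Suc q) k \<longleftrightarrow> (r, c) \<in> E2"
      using q unfolding E2_def E1_def F_def
      by (auto simp: shift_row_iff Suc_le_eq le_less less_Suc_eq)
  qed
  ultimately have "\<rho> F = \<rho> E2 + Suc n"
    using rank_unit kohnert_poset_closed assms(2) F unit_move_kohnert by blast
  moreover have "\<rho> E = \<rho> F + 1"
    using rank_unit[of 1 E F] F assms(2) by (simp add: relcompp_apply eq_OO)
  moreover have "\<rho> E = \<rho> E1 + n" using rank_unit E1 assms(2) by blast
  moreover have "\<rho> E1 = \<rho> E2 + 1" using cov E1P E2P c by blast
  ultimately show False by simp
qed

subsection \<open>From an obstruction to a blocked jump\<close>

lemma highest_empty_below_exists:
  assumes "1 \<le> g" "g < s" "(g, c) \<notin> D"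
  shows "\<exists>s' \<ge> g. highest_empty_below D s c s'"
proof -
  let ?S = "{r. 1 \<le> r \<and> r < s \<and> (r, c) \<notin> D}"
  define q where "q = Max ?S"
  have S: "finite ?S" "g \<in> ?S" using assms by auto
  then have "q \<in> ?S" unfolding q_def by (intro Max_in) auto
  moreover have "r \<le> q" if "r \<in> ?S" for r unfolding q_def using S(1) that by (rule Max_ge)
  ultimately show ?thesis
    unfolding highest_empty_below_def using S(2) by (intro exI[of _ q]) auto
qed

text \<open>The state of the descent from a ranking obstruction to a blocked jump: the three cells are
  \<open>(R, k)\<close>, \<open>(r2, k)\<close>, \<open>(r3, m)\<close>. The empty position \<open>(h, k)\<close> is pushed up to row \<open>R - 1\<close>; until it
  is there, an empty position of column \<open>m\<close> at or below row \<open>h\<close> keeps the cells of column \<open>m\<close> from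
  obstructing this.\<close>

definition descent_state :: "cell set \<Rightarrow> nat \<Rightarrow> nat \<Rightarrow> nat \<Rightarrow> nat \<Rightarrow> nat \<Rightarrow> nat \<Rightarrow> bool" where
  "descent_state D R k m r2 r3 h \<longleftrightarrow>
     diagram D \<and> (R, k) \<in> D \<and> (r2, k) \<in> D \<and> (r3, m) \<in> D \<and> k < m \<and> R < r2 \<and> r2 \<le> r3 \<and>
     1 \<le> h \<and> h < R \<and> (h, k) \<notin> D \<and> (Suc h = R \<or> (\<exists>g \<ge> 1. g \<le> h \<and> (g, m) \<notin> D)) \<and>
     (\<forall>r c. (r, c) \<in> D \<longrightarrow> r \<le> r3 \<longrightarrow> c \<le> m) \<and>
     (\<forall>r c. (r, c) \<in> D \<longrightarrow> r \<le> r3 \<longrightarrow> k < c \<longrightarrow> c < m \<longrightarrow>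
        R < r \<and> (\<forall>r'. (r', c) \<in> D \<longrightarrow> r' \<le> r3 \<longrightarrow> r' = r)) \<and>
     cells_below D m r3 < R"

text \<open>Up to row \<open>r3\<close> nothing lies to the right of column \<open>m\<close>, so its
  cells there are free to move. Staying below row \<open>r3\<close>, the cell leaves the count
  unchanged.\<close>

lemma descent_lower_last_column:
  assumes st: "descent_state D R k m r2 r3 h" and s: "(s, m) \<in> D" "s < r3"
    and g: "1 \<le> g" "g < s" "(g, m) \<notin> D" and "Suc h = R \<or> s \<le> h"
  shows "\<exists>D'. kohnert_move D D' \<and> descent_state D' R k m r2 r3 h"
proof -
  obtain s' where he: "highest_empty_below D s m s'"
    using highest_empty_below_exists[OF g] by blast
  then have s': "1 \<le> s'" "s' < s" "(s', m) \<notin> D" unfolding highest_empty_below_def by auto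
  define D' where "D' = insert (s', m) (D - {(s, m)})"
  have "rightmost_in_row D s m"
    using st s unfolding rightmost_in_row_def descent_state_def by auto
  then have mv: "kohnert_move D D'" unfolding kohnert_move_def D'_def using he by blast
  have "cells_below D' m r3 = cells_below D m r3"
    unfolding D'_def using s s' by (intro cells_below_lower)
  moreover have "diagram D'" using mv kohnert_move_diagram st unfolding descent_state_def by blast
  \<comment> \<open>The position \<open>(s, m)\<close> just vacated serves as the empty one.\<close>
  moreover have "Suc h = R \<or> (\<exists>g \<ge> 1. g \<le> h \<and> (g, m) \<notin> D')"
    using assms(7) s' unfolding D'_def by (auto intro!: exI[of _ s])
  ultimately have "descent_state D' R k m r2 r3 h"
    using st s s' unfolding descent_state_def D'_def by auto
  then show ?thesis using mv by blast
qed

text \<open>Below row \<open>R\<close> only columns \<open>k\<close> and \<open>m\<close> can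
  contain cells from column \<open>k\<close> on, so the shift meets no obstacle. It empties row
  \<open>Suc h\<close> in both columns at once, which moves the hole up and renews the empty
  position of column \<open>m\<close>.\<close>

lemma descent_shift_hole:
  assumes st: "descent_state D R k m r2 r3 h"
    and h: "Suc h < R" "(Suc h, k) \<in> D" "(h, m) \<notin> D"
  shows "kohnert_move\<^sup>+\<^sup>+ D (shift_row D h k) \<and> descent_state (shift_row D h k) R k m r2 r3 (Suc h)"
proof -
  let ?D' = "shift_row D h k"
  have fin: "finite D" using st unfolding descent_state_def diagram_def by blast
  have c: "c = k \<or> c = m" if "k \<le> c" "(Suc h, c) \<in> D" for c
  proof (rule ccontr)
    assume "\<not> ?thesis"
    moreover have "Suc h \<le> r3" using st h(1) unfolding descent_state_def by auto
    moreover then have "c \<le> m" using st that(2) unfolding descent_state_def by blast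
    ultimately have "R < Suc h"
      using st that unfolding descent_state_def by (metis le_neq_implies_less)
    then show False using h(1) by simp
  qed
  then have e: "\<forall>c \<ge> k. (Suc h, c) \<in> D \<longrightarrow> (h, c) \<notin> D"
    using st h(3) unfolding descent_state_def by blast
  have mv: "kohnert_move\<^sup>+\<^sup>+ D ?D'"
    using st h(2) e fin unfolding descent_state_def by (intro shift_row_reachable) auto
  have dia: "diagram ?D'"
    using kohnert_moves_diagram[OF tranclp_into_rtranclp[OF mv]] st unfolding descent_state_def by blast
  have km: "k < m" "R < r2" "r2 \<le> r3" using st unfolding descent_state_def by auto
  have "cells_below ?D' m r3 \<le> cells_below D m r3"
  proof (cases "(Suc h, m) \<in> D")
    case True
    have "cells_below ?D' m r3 = cells_below (insert (h, m) (D - {(Suc h, m)})) m r3"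
      unfolding cells_below_def
      using True km by (intro arg_cong[where f = card]) (auto simp: shift_row_iff)
    also have "\<dots> = cells_below D m r3"
      using True h km st unfolding descent_state_def by (intro cells_below_lower) auto
    finally show ?thesis by simp
  next
    case False
    then show ?thesis unfolding cells_below_def by (intro card_mono) (auto simp: shift_row_iff)
  qed
  moreover have "c \<le> m" if "(r, c) \<in> ?D'" "r \<le> r3" for r c
    using that st h(1) km unfolding descent_state_def shift_row_iff by auto
  moreover have "R < r \<and> (\<forall>r'. (r', c) \<in> ?D' \<longrightarrow> r' \<le> r3 \<longrightarrow> r' = r)"
    if "(r, c) \<in> ?D'" "r \<le> r3" "k < c" "c < m" for r c
  proof -
    have "(Suc h, c) \<notin> D" using c[of c] that by auto
    then have "(r', c) \<in> ?D' \<longleftrightarrow> (r', c) \<in> D" for r'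
      using that by (auto simp: shift_row_iff)
    then show ?thesis using that st unfolding descent_state_def by blast
  qed
  moreover have "Suc (Suc h) = R \<or> (\<exists>g \<ge> 1. g \<le> Suc h \<and> (g, m) \<notin> ?D')"
    using km by (intro disjI2 exI[of _ "Suc h"]) (simp add: shift_row_iff)
  moreover have "(Suc h, k) \<notin> ?D'" by (simp add: shift_row_iff)
  moreover have "(R, k) \<in> ?D'" "(r2, k) \<in> ?D'" "(r3, m) \<in> ?D'"
    using st h(1) unfolding descent_state_def shift_row_iff by auto
  ultimately have "descent_state ?D' R k m r2 r3 (Suc h)"
    using st h(1) dia unfolding descent_state_def by auto
  then show ?thesis using mv by blast
qed

lemma descent_lower_third:
  assumes st: "descent_state D R k m r2 r3 h" and h: "Suc h = R" and r3: "r2 < r3"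
    and e: "(r3 - 1, m) \<notin> D"
  shows "\<exists>D'. kohnert_move D D' \<and> descent_state D' R k m r2 (r3 - 1) h"
proof -
  obtain p where p: "r3 = Suc p" "R < p" using r3 st unfolding descent_state_def by (cases r3) auto
  define D' where "D' = insert (p, m) (D - {(Suc p, m)})"
  have rm: "rightmost_in_row D (Suc p) m"
    using st p unfolding rightmost_in_row_def descent_state_def by auto
  have mv: "kohnert_move D D'"
    unfolding D'_def using e p rm by (intro unit_move_kohnert unit_moveI) auto
  have "cells_below D' m p \<le> cells_below D m r3"
    unfolding cells_below_def D'_def using p by (intro card_mono) auto
  moreover have "diagram D'" using mv kohnert_move_diagram st unfolding descent_state_def by blast
  ultimately have "descent_state D' R k m r2 p h"
    using st p r3 h unfolding descent_state_def D'_def by auto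
  then show ?thesis using mv p by auto
qed

text \<open>The second and third cells come down together with all cells between them in their row.
  An intermediate column has at most one cell up to that row, so its place in row \<open>p\<close>
  is empty.\<close>

lemma descent_shift_top:
  assumes st: "descent_state D R k m r2 r2 h" and h: "Suc h = R" and r2: "r2 = Suc p" "R < p"
    and e: "(p, k) \<notin> D" "(p, m) \<notin> D"
  shows "kohnert_move\<^sup>+\<^sup>+ D (shift_row D p k) \<and> descent_state (shift_row D p k) R k m p p h"
proof -
  let ?D' = "shift_row D p k"
  have fin: "finite D" using st unfolding descent_state_def diagram_def by blast
  have k: "(Suc p, k) \<in> D" and km: "k < m" using st r2 unfolding descent_state_def by auto
  have right: "\<And>r c. (r, c) \<in> D \<Longrightarrow> r \<le> Suc p \<Longrightarrow> c \<le> m"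
    and between: "\<And>r c. (r, c) \<in> D \<Longrightarrow> r \<le> Suc p \<Longrightarrow> k < c \<Longrightarrow> c < m \<Longrightarrow> R < r"
    and unique: "\<And>r r' c. (r, c) \<in> D \<Longrightarrow> r \<le> Suc p \<Longrightarrow> k < c \<Longrightarrow> c < m \<Longrightarrow>
      (r', c) \<in> D \<Longrightarrow> r' \<le> Suc p \<Longrightarrow> r' = r"
    using st r2 unfolding descent_state_def by blast+
  have free: "\<forall>c \<ge> k. (Suc p, c) \<in> D \<longrightarrow> (p, c) \<notin> D"
  proof (intro allI impI)
    fix c assume c: "k \<le> c" "(Suc p, c) \<in> D"
    then consider "c = k" | "c = m" | "k < c" "c < m" using right[of "Suc p" c] by linarith
    then show "(p, c) \<notin> D"
    proof cases
      case 3
      then show ?thesis using unique[of "Suc p" c p] c by auto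
    qed (use e in auto)
  qed
  have mv: "kohnert_move\<^sup>+\<^sup>+ D ?D'"
    using k free fin r2 by (intro shift_row_reachable) auto
  have "diagram ?D'"
    using kohnert_moves_diagram[OF tranclp_into_rtranclp[OF mv]] st unfolding descent_state_def by blast
  moreover have "cells_below ?D' m p \<le> cells_below D m r2"
    unfolding cells_below_def using r2 by (intro card_mono) (auto simp: shift_row_iff)
  moreover have "c \<le> m" if "(r, c) \<in> ?D'" "r \<le> p" for r c
    using that right unfolding shift_row_iff by force
  moreover have "R < r \<and> (\<forall>r'. (r', c) \<in> ?D' \<longrightarrow> r' \<le> p \<longrightarrow> r' = r)"
    if rc: "(r, c) \<in> ?D'" "r \<le> p" "k < c" "c < m" for r c
  proof -
    \<comment> \<open>Cells in rows up to \<open>p\<close> come from rows up to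
      \<open>Suc p\<close>, with the row cut off at \<open>p\<close>; uniqueness in a column is thus
      inherited.\<close>
    have *: "\<exists>s \<le> Suc p. (s, c) \<in> D \<and> r' = min s p" if "(r', c) \<in> ?D'" "r' \<le> p" for r'
      using that unfolding shift_row_iff by (auto intro: exI[of _ r'] exI[of _ "Suc p"])
    then obtain s where s: "s \<le> Suc p" "(s, c) \<in> D" "r = min s p" using rc by blast
    then have "R < r" using between[of s c] rc r2 by simp
    moreover have "r' = r" if "(r', c) \<in> ?D'" "r' \<le> p" for r'
      using *[OF that] s unique rc by blast
    ultimately show ?thesis by blast
  qed
  moreover have "(R, k) \<in> ?D'" "(h, k) \<notin> ?D'" "(p, k) \<in> ?D'" "(p, m) \<in> ?D'"
    using st r2 h unfolding descent_state_def shift_row_iff by auto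
  ultimately have "descent_state ?D' R k m p p h"
    using st r2 h unfolding descent_state_def by auto
  then show ?thesis using mv by blast
qed

text \<open>Each term of the measure covers one kind of progress: an actual move, a lower choice of
  the second cell, or a hole that rises for free because the position above it is already
  empty.\<close>

lemma descent_step:
  assumes st: "descent_state D R k m r2 r3 h"
  shows "(\<exists>q. blocked_jump D q k) \<or>
    (\<exists>D' r2' r3' h'. kohnert_move\<^sup>*\<^sup>* D D' \<and> descent_state D' R k m r2' r3' h' \<and>
       weight D' + r2' + (R - h') < weight D + r2 + (R - h))" (is "_ \<or> ?smaller")
proof -
  have D: "diagram D" and hk: "(h, k) \<notin> D" "1 \<le> h" "h < R" and below: "cells_below D m r3 < R"
    and R: "(R, k) \<in> D" "R < r2" "r2 \<le> r3" and r3: "(r3, m) \<in> D" and km: "k < m"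
    and r2k: "(r2, k) \<in> D"
    using st unfolding descent_state_def by auto
  have dec: "weight D' < weight D" if "kohnert_move\<^sup>+\<^sup>+ D D'" for D'
    using weight_kohnert_moves[OF that D] .
  have lower: ?smaller
    if *: "(s, m) \<in> D" "s < r3" "1 \<le> g" "g < s" "(g, m) \<notin> D" "Suc h = R \<or> s \<le> h" for s g
  proof -
    obtain D' where mv: "kohnert_move D D'" and "descent_state D' R k m r2 r3 h"
      using descent_lower_last_column[OF st *] by blast
    then show ?thesis using mv dec[OF tranclp.r_into_trancl[of kohnert_move, OF mv]] by (intro exI[of _ D'] exI) auto
  qed
  show ?thesis
  proof (cases "Suc h = R")
    case False
    then have h: "Suc h < R" using hk by simp
    then obtain g where g: "1 \<le> g" "g \<le> h" "(g, m) \<notin> D"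
      using st unfolding descent_state_def by auto
    consider "(h, m) \<in> D" | "(Suc h, k) \<notin> D" | "(h, m) \<notin> D" "(Suc h, k) \<in> D" by blast
    then show ?thesis
    proof cases
      case 1
      then have "g < h" using g by (metis le_neq_implies_less)
      then show ?thesis using lower[of h g] 1 g hk R by simp
    next
      case 2
      then have "descent_state D R k m r2 r3 (Suc h)"
        using st h g unfolding descent_state_def by auto
      then show ?thesis using hk by (intro disjI2 exI[of _ D] exI) auto
    next
      case 3
      then show ?thesis
        using descent_shift_hole[OF st h 3(2,1)] dec[of "shift_row D h k"]
        by (intro disjI2 exI[of _ "shift_row D h k"] exI) (auto dest: tranclp_into_rtranclp)
    qed
  next
    case h: True
    show ?thesis
    proof (cases "\<exists>s \<ge> R. s < r3 \<and> (s, m) \<in> D")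
      case True
      then obtain s where s: "s \<ge> R" "s < r3" "(s, m) \<in> D" by blast
      \<comment> \<open>If column \<open>m\<close> were full up to row \<open>s\<close>, it would
        have at least \<open>R\<close> cells below row \<open>r3\<close>.\<close>
      have "\<exists>g \<ge> 1. g < s \<and> (g, m) \<notin> D"
      proof (rule ccontr)
        assume "\<not> ?thesis"
        then have "\<forall>r. 1 \<le> r \<and> r \<le> s \<longrightarrow> (r, m) \<in> D" using s(3) by (metis le_neq_implies_less)
        then have "cells_below D m (Suc s) = s" by (rule cells_below_full)
        then show False using cells_below_mono[of "Suc s" r3 D m] s below by simp
      qed
      then show ?thesis using lower[of s] s h by blast
    next
      case False
      then have e: "\<And>s. R \<le> s \<Longrightarrow> s < r3 \<Longrightarrow> (s, m) \<notin> D" by blast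
      show ?thesis
      proof (cases "r2 < r3")
        case True
        then obtain D' where mv: "kohnert_move D D'" and "descent_state D' R k m r2 (r3 - 1) h"
          using descent_lower_third[OF st h True] e[of "r3 - 1"] R by auto
        then show ?thesis using mv dec[OF tranclp.r_into_trancl[of kohnert_move, OF mv]] by (intro disjI2 exI[of _ D'] exI) auto
      next
        case False
        then have r23: "r3 = r2" using R by simp
        obtain p where p: "r2 = Suc p" "R \<le> p" using R(2) by (cases r2) auto
        consider "R = p" | "R < p" "(p, k) \<in> D" | "R < p" "(p, k) \<notin> D" using p by linarith
        then show ?thesis
        proof cases
          case 1
          \<comment> \<open>Row \<open>R\<close> is empty to the right of \<open>k\<close>:
            intermediate columns have cells only above \<open>R\<close>, column \<open>m\<close> has
            been cleared, and nothing lies beyond it.\<close>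
          have "(R, c) \<notin> D" if "k < c" for c
            using that e[of R] st 1 p r23 unfolding descent_state_def
            by (metis le_Suc_eq le_neq_implies_less less_irrefl lessI)
          then have "blocked_jump D h k"
            unfolding blocked_jump_def using hk h R r2k r3 r23 p 1 km by auto
          then show ?thesis by blast
        next
          case 2
          then have "descent_state D R k m p r3 h"
            using st p r23 unfolding descent_state_def by auto
          then show ?thesis using p by (intro disjI2 exI[of _ D] exI) auto
        next
          case 3
          then have "kohnert_move\<^sup>+\<^sup>+ D (shift_row D p k) \<and> descent_state (shift_row D p k) R k m p p h"
            using st h p r23 e[of p] by (intro descent_shift_top) auto
          then show ?thesis
            using dec[of "shift_row D p k"] p
            by (intro disjI2 exI[of _ "shift_row D p k"] exI) (auto dest: tranclp_into_rtranclp)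
        qed
      qed
    qed
  qed
qed

lemma descent_blocked_jump:
  "descent_state D R k m r2 r3 h \<Longrightarrow> \<exists>E q. kohnert_move\<^sup>*\<^sup>* D E \<and> blocked_jump E q k"
proof (induction "weight D + r2 + (R - h)" arbitrary: D r2 r3 h rule: less_induct)
  case less
  from descent_step[OF less.prems] show ?case
  proof (elim disjE exE conjE)
    fix D' r2' r3' h'
    assume D': "kohnert_move\<^sup>*\<^sup>* D D'" "descent_state D' R k m r2' r3' h'"
      "weight D' + r2' + (R - h') < weight D + r2 + (R - h)"
    then obtain E q where "kohnert_move\<^sup>*\<^sup>* D' E" "blocked_jump E q k" using less.hyps by blast
    then show ?thesis using D'(1) by (meson rtranclp_trans)
  qed auto
qed

section \<open>Extremal choice of the obstruction\<close>

lemma obstruction_descent_state: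
  assumes "diagram D" "northeast D" "ranking_obstruction D r1 r2 r3 c1 c3"
  shows "\<exists>R k m r2 r3 h. descent_state D R k m r2 r3 h"
proof -
  have cols: "c \<le> Max (snd ` D)" if "(r, c) \<in> D" for r c
    using that assms(1) unfolding diagram_def by (force intro!: Max_ge)
  text \<open>Maximality of \<open>k\<close> leaves at most one cell per column between \<open>k\<close> and \<open>m\<close> in rows up to
    \<open>r3\<close>, since two would start a new obstruction; maximality of \<open>m\<close> clears the columns beyond.\<close>
  define ex where "ex k \<longleftrightarrow> (\<exists>R r2 r3 m. ranking_obstruction D R r2 r3 k m)" for k
  have "ex c1" "\<And>k. ex k \<Longrightarrow> k \<le> Max (snd ` D)"
    using assms(3) cols unfolding ex_def ranking_obstruction_def by blast+
  then have "ex (Greatest ex)" "\<And>k'. ex k' \<Longrightarrow> k' \<le> Greatest ex"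
    using GreatestI_nat[of ex] Greatest_le_nat[of ex] by blast+
  then obtain k where k: "ex k" and kmax: "\<And>k'. ex k' \<Longrightarrow> k' \<le> k" by blast
  then obtain R r2 r3 m0 where ob0: "ranking_obstruction D R r2 r3 k m0" unfolding ex_def by blast
  have "(r3, m0) \<in> D" "\<And>c. (r3, c) \<in> D \<Longrightarrow> c \<le> Max (snd ` D)"
    using ob0 cols unfolding ranking_obstruction_def by blast+
  then have "(r3, GREATEST c. (r3, c) \<in> D) \<in> D"
    "\<And>c. (r3, c) \<in> D \<Longrightarrow> c \<le> (GREATEST c. (r3, c) \<in> D)"
    using GreatestI_nat[of "\<lambda>c. (r3, c) \<in> D"] Greatest_le_nat[of "\<lambda>c. (r3, c) \<in> D"] by blast+
  then obtain m where m: "(r3, m) \<in> D" "\<And>c. (r3, c) \<in> D \<Longrightarrow> c \<le> m" by blast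
  have m0: "m0 \<le> m" using m(2) ob0 unfolding ranking_obstruction_def by blast
  have R: "(R, k) \<in> D" "(r2, k) \<in> D" "R < r2" "r2 \<le> r3" "k < m"
    using ob0 m0 unfolding ranking_obstruction_def by auto
  have few: "cells_below D c r3 < R" if "m0 \<le> c" for c
    using ob0 that unfolding ranking_obstruction_def by blast
  have not_full: "\<exists>r. 1 \<le> r \<and> r \<le> R \<and> (r, c) \<notin> D" if "m0 \<le> c" for c
  proof (rule ccontr)
    assume "\<not> ?thesis"
    then have "cells_below D c (Suc R) = R" by (intro cells_below_full) auto
    then show False using cells_below_mono[of "Suc R" r3 D c] few[OF that] R by simp
  qed
  \<comment> \<open>This extends (c) to all columns from \<open>k\<close> on, so that
    \<open>m\<close> can replace \<open>m0\<close>. If a column has a cell below row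
    \<open>R\<close>, then by the northeast property its empty position up to row \<open>R\<close>
    is not in row \<open>R\<close> itself.\<close>
  have hole: "\<exists>r. 1 \<le> r \<and> r < R \<and> (r, c) \<notin> D" if "k \<le> c" for c
  proof (cases "c < m0")
    case True
    then show ?thesis using ob0 that unfolding ranking_obstruction_def by blast
  next
    case False
    obtain r0 where "1 \<le> r0" "r0 < R"
      using ob0 unfolding ranking_obstruction_def by auto
    moreover obtain r where r: "1 \<le> r" "r \<le> R" "(r, c) \<notin> D" using not_full[of c] False by auto
    ultimately show ?thesis
      using northeastD[OF assms(2) R(1), of r0 c] that by (metis le_neq_implies_less less_imp_le)
  qed
  have ob: "ranking_obstruction D R r2 r3 k m"
    using R m hole few m0 unfolding ranking_obstruction_def by auto
  have right: "c \<le> m" if "(r, c) \<in> D" "r \<le> r3" for r c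
    using northeastD[OF assms(2) m(1) that(1,2)] m(2) by force
  have shift: False if "k < c" "c < m" "R \<le> a" "a < b" "b \<le> r3" "(a, c) \<in> D" "(b, c) \<in> D" for a b c
  proof -
    have "\<exists>r. 1 \<le> r \<and> r < a \<and> (r, d) \<notin> D" if "c \<le> d" for d
      using hole[of d] that \<open>k < c\<close> \<open>R \<le> a\<close> by (metis le_trans less_imp_le less_le_trans)
    moreover have "cells_below D d r3 < a" if "m \<le> d" for d
      using few[of d] that m0 \<open>R \<le> a\<close> by simp
    ultimately have "ranking_obstruction D a b r3 c m"
      unfolding ranking_obstruction_def using that m by auto
    then show False using kmax[of c] \<open>k < c\<close> unfolding ex_def by (metis not_le)
  qed
  have between: "R < r \<and> (\<forall>r'. (r', c) \<in> D \<longrightarrow> r' \<le> r3 \<longrightarrow> r' = r)"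
    if rc: "(r, c) \<in> D" "r \<le> r3" "k < c" "c < m" for r c
  proof -
    \<comment> \<open>A cell in row \<open>R\<close> or lower would, combined with
      \<open>(R, k)\<close> and \<open>(r2, k)\<close>, put two cells into its column.\<close>
    have above: "R < r" if "(r, c) \<in> D" for r
    proof (rule ccontr)
      assume "\<not> R < r"
      then have "(R, c) \<in> D" "(r2, c) \<in> D"
        using northeastD[OF assms(2) _ that] R rc(3) by auto
      then show False using shift[of c R r2] rc R by blast
    qed
    moreover have "r' = r" if "(r', c) \<in> D" "r' \<le> r3" for r'
      using shift[of c r r'] shift[of c r' r] above[OF that(1)] above[OF rc(1)] that rc
      by (metis linorder_neqE_nat less_imp_le)
    ultimately show ?thesis using rc by blast
  qed
  obtain r where "1 \<le> r" "r < R" "(r, k) \<notin> D" using hole[of k] by auto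
  then obtain h where he: "highest_empty_below D R k h"
    using highest_empty_below_exists by blast
  then have h: "1 \<le> h" "h < R" "(h, k) \<notin> D"
    unfolding highest_empty_below_def by auto
  note filled = highest_empty_below_filled[OF he]
  \<comment> \<open>Otherwise an empty position of column \<open>m\<close> up to row
    \<open>R\<close> lies above \<open>h\<close>, where column \<open>k\<close> is filled because
    \<open>h\<close> is its highest hole; \<open>(h, m)\<close> and the northeast property then fill
    it.\<close>
  have "\<exists>g \<ge> 1. g \<le> h \<and> (g, m) \<notin> D"
  proof (rule ccontr)
    assume "\<not> ?thesis"
    then have low: "\<And>g. 1 \<le> g \<Longrightarrow> g \<le> h \<Longrightarrow> (g, m) \<in> D" by blast
    obtain r where r: "1 \<le> r" "r \<le> R" "(r, m) \<notin> D" using not_full m0 by blast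
    then have "h < r" using low by force
    then have "(r, k) \<in> D" using filled R(1) r(2) by (metis le_neq_implies_less)
    then show False using northeastD[OF assms(2) _ low[OF h(1)]] r h \<open>h < r\<close> R(5) by auto
  qed
  then have "descent_state D R k m r2 r3 h"
    unfolding descent_state_def using assms(1) R m h right between few m0 by blast
  then show ?thesis by blast
qed

lemma obstructed_not_ranked:
  assumes "diagram D0" "northeast D0" "ranking_obstruction D0 r1 r2 r3 c1 c3"
  shows "\<not> ranked (kohnert_poset D0) kohnert_less"
proof -
  obtain R k m r2 r3 h where "descent_state D0 R k m r2 r3 h"
    using obstruction_descent_state[OF assms] by blast
  then obtain E q where "kohnert_move\<^sup>*\<^sup>* D0 E" "blocked_jump E q k"
    using descent_blocked_jump by blast
  then show ?thesis
    using blocked_jump_not_ranked[OF assms(1)] unfolding kohnert_poset_def by blast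
qed

theorem theorem1p4:
  fixes D0 :: "(nat \<times> nat) set"
  assumes "diagram D0" and "northeast D0"
  shows "ranked (kohnert_poset D0) kohnert_less \<longleftrightarrow>
    \<not> (\<exists>r1 c1 r2 c2 r3 c3.
         (r1, c1) \<in> D0 \<and> (r2, c2) \<in> D0 \<and> (r3, c3) \<in> D0 \<and>
         (r1 < r2 \<and> r2 \<le> r3) \<and>
         (c1 = c2 \<and> c2 < c3) \<and>
         (\<forall>c. c1 \<le> c \<and> c < c3 \<longrightarrow> (\<exists>r. 1 \<le> r \<and> r < r1 \<and> (r, c) \<notin> D0)) \<and>
         (\<forall>c. c3 \<le> c \<longrightarrow> card {r. 1 \<le> r \<and> r < r3 \<and> (r, c) \<in> D0} < r1))"
proof -
  have "ranked (kohnert_poset D0) kohnert_less \<longleftrightarrow>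
      (\<nexists>r1 r2 r3 c1 c3. ranking_obstruction D0 r1 r2 r3 c1 c3)"
    using unobstructed_ranked[OF assms] obstructed_not_ranked[OF assms] by blast
  then show ?thesis unfolding ranking_obstruction_def cells_below_def by blast
qed

end
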